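(* Let $n\ge 1$ and let $f(X)=a_0+a_1X+\cdots+a_nX^n$ be an Eneström–Kakeya polynomial of degree $n$ with integer coefficients, $a_0\neq 0$. If $f(-1)\neq 0$ and $|f(b)|$ is a prime number for some integer $b$ with $|b|\ge 2$, then $f$ is irreducible over $\mathbb{Q}$.
   Context: A polynomial $f(X)=a_0+a_1X+\cdots+a_nX^n$ with real coefficients is called an Eneström–Kakeya polynomial if $0\le a_0\le a_1\le\cdots\le a_n$. *)

theory Defs
  imports Complex_Main "HOL-Computational_Algebra.Computational_Algebra"
begin

text \<open>Taking \<open>n\<close> to be the degree loses nothing: if a chain
  \<open>0 \<le> a\<^sub>0 \<le> \<dots> \<le> a\<^sub>n\<close> ends in \<open>a\<^sub>n = 0\<close>, then all coefficients vanish.\<close>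

definition enestrom_kakeya :: "real poly \<Rightarrow> bool" where
  "enestrom_kakeya f \<longleftrightarrow>
     0 \<le> coeff f 0 \<and> (\<forall>i < degree f. coeff f i \<le> coeff f (Suc i))"

end

theory Submission
  imports Defs
begin

text \<open>
  By the Enestroem-Kakeya theorem all complex roots of \<open>f\<close> lie in the closed unit disc. The only
  points \<open>z\<close> of that disc with \<open>\<bar>b - z\<bar> \<le> 1\<close> for an integer \<open>\<bar>b\<bar> \<ge> 2\<close> are \<open>\<plusminus>1\<close>, and these are not
  roots. Hence every nonconstant integer factor \<open>g\<close> of \<open>f\<close> satisfies \<open>\<bar>g(b)\<bar> > 1\<close>. By Gauss' lemma a
  proper factorisation over the rationals gives two nonconstant integer factors, which would make
  \<open>\<bar>f(b)\<bar>\<close> composite.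
\<close>

lemma map_poly_of_int_mult:
  "map_poly (of_int :: int \<Rightarrow> 'a :: comm_ring_1) (p * q) =
     map_poly of_int p * map_poly of_int q"
  by (intro poly_eqI) (simp add: coeff_map_poly coeff_mult)

lemma poly_map_poly_of_int:
  "poly (map_poly (of_int :: int \<Rightarrow> 'a :: comm_ring_1) p) (of_int x) = of_int (poly p x)"
  by (induction p) (simp_all add: map_poly_pCons)

lemma map_poly_of_int_inject:
  "map_poly (of_int :: int \<Rightarrow> 'a :: {comm_ring_1, ring_char_0}) p = map_poly of_int q \<longleftrightarrow> p = q"
  by (simp add: poly_eq_iff coeff_map_poly)

lemma clear_denominators:
  fixes p :: "rat poly"
  obtains d :: int and q :: "int poly" where "d \<noteq> 0" "smult (of_int d) p = map_poly of_int q"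
proof -
  have "\<exists>d q. d \<noteq> 0 \<and> smult (of_int d) p = map_poly rat_of_int q"
  proof (induction p)
    case 0
    show ?case by (intro exI[of _ 1] exI[of _ 0]) simp
  next
    case (pCons a p)
    then obtain d q where dq: "d \<noteq> 0" "smult (of_int d) p = map_poly rat_of_int q" by blast
    obtain m n :: int where mn: "a = of_int m / of_int n" "n > 0"
      by (metis Fract_of_int_quotient Rat_cases)
    have "smult (of_int (n * d)) p = smult (of_int n) (smult (of_int d) p)"
      by simp
    \<comment> \<open>The factor \<open>n * d\<close> clears both parts: the head becomes
      \<open>n * d * (m / n) = d * m\<close>, the tail \<open>n\<close> times the integer polynomial
      \<open>q\<close>.\<close>
    with dq mn have "smult (of_int (n * d)) (pCons a p) =
        map_poly rat_of_int (pCons (d * m) (smult n q))"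
      by (simp add: map_poly_pCons map_poly_smult)
    with dq mn show ?case by (metis mult_eq_0_iff less_irrefl)
  qed
  with that show thesis by blast
qed

text \<open>Gauss' lemma: after clearing denominators, multiplicativity of the content shows that
  the product of the denominators divides the product of the contents, so it can be cancelled. Only
  nonzero scalars change, which keeps the degrees.\<close>

lemma rat_factorization_imp_int_factorization:
  fixes f :: "int poly" and g h :: "rat poly"
  assumes "f \<noteq> 0" and fac: "map_poly of_int f = g * h"
  obtains G H :: "int poly" where "f = G * H" "degree G = degree g" "degree H = degree h"
proof -
  obtain d G where G: "d \<noteq> 0" "smult (of_int d) g = map_poly of_int G"
    by (rule clear_denominators)
  obtain e H where H: "e \<noteq> 0" "smult (of_int e) h = map_poly of_int H"
    by (rule clear_denominators)
  have "map_poly rat_of_int (smult (d * e) f) = map_poly of_int (G * H)"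
    by (simp add: map_poly_smult map_poly_of_int_mult fac mult.commute flip: G H)
  hence eq: "smult (d * e) f = G * H"
    by (simp only: map_poly_of_int_inject)
  have "\<bar>d * e\<bar> * content f = content H * content G"
    using arg_cong[OF eq, of content] by (simp add: content_mult abs_mult mult.commute)
  \<comment> \<open>\<open>k\<close> is \<open>content f\<close> up to sign; passing to divisibility
    removes the absolute value around \<open>d * e\<close>.\<close>
  then obtain k where k: "content H * content G = d * e * k"
    by (metis abs_dvd_iff dvd_def dvd_triv_left)
  have "smult (d * e) f =
      smult (content G) (primitive_part G) * smult (content H) (primitive_part H)"
    by (simp only: eq content_times_primitive_part)
  also have "\<dots> = smult (content H * content G) (primitive_part G * primitive_part H)"
    by (simp only: mult_smult_left mult_smult_right smult_smult)
  also have "\<dots> = smult (d * e) (smult k (primitive_part G * primitive_part H))"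
    by (simp add: k)
  finally have "f = smult k (primitive_part G * primitive_part H)"
    by (rule smult_cancel[rotated]) (simp add: G(1) H(1))
  hence f: "f = smult k (primitive_part G) * primitive_part H"
    by (simp only: mult_smult_left)
  have "degree G = degree g" "degree H = degree h"
    using arg_cong[OF G(2), of degree] arg_cong[OF H(2), of degree] G(1) H(1)
    by (simp_all add: degree_map_poly)
  \<comment> \<open>Needed so that scaling \<open>primitive_part G\<close> by \<open>k\<close> keeps
    its degree.\<close>
  moreover have "k \<noteq> 0"
    using f assms(1) by auto
  ultimately show thesis
    using that[OF f] by simp
qed

lemma enestrom_kakeya_coeff_nonneg:
  assumes "enestrom_kakeya p"
  shows "0 \<le> coeff p i"
proof (cases "i \<le> degree p")
  case True
  thus ?thesis
  proof (induction i)
    case 0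
    show ?case using assms by (simp add: enestrom_kakeya_def)
  next
    case (Suc i)
    hence "coeff p i \<le> coeff p (Suc i)"
      using assms by (simp add: enestrom_kakeya_def)
    with Suc show ?case by simp
  qed
qed (simp add: coeff_eq_0)

text \<open>Multiplication by \<open>1 - z\<close> turns the coefficients into the nonnegative
  differences \<open>a (Suc i) - a i\<close>, apart from the top term. If \<open>norm z > 1\<close>,
  that top term dominates all the others together.\<close>

lemma enestrom_kakeya_norm_root_le_1:
  fixes z :: complex
  assumes ek: "enestrom_kakeya p" and "p \<noteq> 0" and root: "poly (map_poly of_real p) z = 0"
  shows "norm z \<le> 1"
proof (rule ccontr)
  assume "\<not> norm z \<le> 1"
  hence z: "norm z > 1" by simp
  define a where "a = coeff p"
  define S where "S m = (\<Sum>i\<le>m. of_real (a i) * z ^ i)" for m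
  \<comment> \<open>The expression equals \<open>a 0\<close> plus the sum of
    \<open>(a i - a (i - 1)) * z ^ i\<close> for \<open>1 \<le> i \<le> m\<close>. These
    coefficients add up to \<open>a m\<close>, and every power is at most \<open>norm z ^ m\<close>
    in norm.\<close>
  have bound: "norm ((1 - z) * S m + of_real (a m) * z ^ Suc m) \<le> a m * norm z ^ m"
    if "m \<le> degree p" for m
    using that
  proof (induction m)
    case 0
    show ?case using ek by (simp add: S_def algebra_simps a_def enestrom_kakeya_def)
  next
    case (Suc m)
    have le: "a m \<le> a (Suc m)"
      using ek Suc.prems by (simp add: enestrom_kakeya_def a_def)
    have a: "0 \<le> a m"
      using enestrom_kakeya_coeff_nonneg[OF ek] by (simp add: a_def)
    have "(1 - z) * S (Suc m) + of_real (a (Suc m)) * z ^ Suc (Suc m) =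
        ((1 - z) * S m + of_real (a m) * z ^ Suc m) + of_real (a (Suc m) - a m) * z ^ Suc m"
      by (simp add: S_def algebra_simps)
    also have "norm \<dots> \<le> a m * norm z ^ m + (a (Suc m) - a m) * norm z ^ Suc m"
    proof (rule order.trans[OF norm_triangle_ineq add_mono])
      show "norm ((1 - z) * S m + of_real (a m) * z ^ Suc m) \<le> a m * norm z ^ m"
        using Suc by simp
      show "norm (of_real (a (Suc m) - a m) * z ^ Suc m) \<le> (a (Suc m) - a m) * norm z ^ Suc m"
        using le by (simp only: norm_mult norm_power norm_of_real)
    qed
    also have "a m * norm z ^ m \<le> a m * norm z ^ Suc m"
      using z a by (intro mult_left_mono power_increasing) auto
    finally show ?case by (simp add: algebra_simps)
  qed
  have pos: "a (degree p) > 0"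
    using enestrom_kakeya_coeff_nonneg[OF ek, of "degree p"] \<open>p \<noteq> 0\<close> by (simp add: a_def less_le)
  have "S (degree p) = 0"
    using root by (simp add: S_def a_def poly_altdef degree_map_poly coeff_map_poly)
  \<comment> \<open>At a root only the top term survives on the left of
    \<open>bound\<close>.\<close>
  with bound[of "degree p"] have "a (degree p) * norm z ^ Suc (degree p) \<le> a (degree p) * norm z ^ degree p"
    using pos by (simp add: norm_mult norm_power)
  hence "norm z ^ Suc (degree p) \<le> norm z ^ degree p"
    using pos by (simp only: mult_le_cancel_left_pos)
  with z show False
    by (simp only: power_increasing_iff)
qed

text \<open>The closed unit discs around 0 and \<open>b\<close> can meet only if
  \<open>\<bar>b\<bar> = 2\<close>, and then they touch in the single point \<open>b / 2\<close>. In
  the proof, real parts force \<open>\<bar>Re z\<bar> = 1\<close>, after which no room is left for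
  \<open>Im z\<close>.\<close>

lemma norm_int_diff_gt_1:
  fixes z :: complex and b :: int
  assumes "\<bar>b\<bar> \<ge> 2" "norm z \<le> 1" "z \<noteq> 1" "z \<noteq> -1"
  shows "norm (of_int b - z) > 1"
proof (rule ccontr)
  assume "\<not> norm (of_int b - z) > 1"
  hence "\<bar>of_int b - Re z\<bar> \<le> 1"
    using abs_Re_le_cmod[of "of_int b - z"] by simp
  moreover have "\<bar>Re z\<bar> \<le> 1"
    using abs_Re_le_cmod[of z] assms by linarith
  moreover have "(of_int b :: real) \<ge> 2 \<or> (of_int b :: real) \<le> -2"
    using assms(1) by linarith
  ultimately have re: "Re z = 1 \<or> Re z = -1"
    by linarith
  have "(Re z)\<^sup>2 + (Im z)\<^sup>2 \<le> 1"
    using assms(2) by (simp add: cmod_def)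
  with re have "Im z = 0" by auto
  with re assms(3,4) show False
    by (auto simp: complex_eq_iff)
qed

text \<open>Over the complex numbers \<open>poly p x\<close> is the leading coefficient times the
  product of all \<open>x - z\<close> over the roots \<open>z\<close>.\<close>

lemma norm_poly_gt_1:
  fixes p :: "complex poly"
  assumes lc: "norm (lead_coeff p) \<ge> 1" and "degree p > 0"
    and roots: "\<And>z. poly p z = 0 \<Longrightarrow> norm (x - z) > 1"
  shows "norm (poly p x) > 1"
proof -
  have "p \<noteq> 0" using assms(2) by auto
  then obtain A where A: "size A = degree p"
    "p = smult (lead_coeff p) (\<Prod>z\<in>#A. [:-z, 1:])"
    using alg_closed_imp_factorization by blast
  have "poly p z = 0" if "z \<in># A" for z
    using that by (subst A(2)) (auto simp: poly_prod_mset image_iff prod_mset_zero_iff)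
  hence gt: "norm (x - z) > 1" if "z \<in># A" for z
    using roots that by blast
  have "(\<Prod>z\<in>#B. norm (x - z)) \<ge> 1" if "\<forall>z\<in>#B. norm (x - z) > 1" for B
    using that
  proof (induction B)
    case (add z B)
    have "1 * 1 \<le> norm (x - z) * (\<Prod>z\<in>#B. norm (x - z))"
      using add by (intro mult_mono) auto
    thus ?case by simp
  qed simp
  note prod_ge = this
  \<comment> \<open>One root is split off to make the inequality strict: the product over the
    possibly empty rest \<open>B\<close> is only known to be at least 1.\<close>
  obtain z B where B: "A = add_mset z B"
    using A(1) assms(2) by (metis multiset_cases size_empty less_irrefl)
  have "1 < norm (x - z) * (\<Prod>z\<in>#B. norm (x - z))"
    using gt B prod_ge[of B] by (intro less_1_mult') auto
  also have "\<dots> \<le> norm (lead_coeff p) * \<dots>"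
    using lc calculation by (simp add: mult_le_cancel_right1)
  also have "norm (x - z) * (\<Prod>z\<in>#B. norm (x - z)) = norm (\<Prod>z\<in>#A. x - z)"
  proof -
    have "norm (\<Prod>z\<in>#C. x - z) = (\<Prod>z\<in>#C. norm (x - z))" for C
      by (induction C) (simp_all add: norm_mult)
    thus ?thesis by (simp add: B norm_mult)
  qed
  also have "norm (lead_coeff p) * \<dots> = norm (poly p x)"
    by (subst (3) A(2)) (simp add: poly_prod_mset norm_mult multiset.map_comp o_def)
  finally show ?thesis .
qed

text \<open>The value at 1 is the sum of the coefficients. This excludes 1 as a root of
  \<open>f\<close>.\<close>

lemma poly_1_pos_if_enestrom_kakeya:
  assumes ek: "enestrom_kakeya p" and "p \<noteq> 0"
  shows "poly p 1 > 0"
proof -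
  note nonneg = enestrom_kakeya_coeff_nonneg[OF ek]
  have "lead_coeff p > 0"
    using nonneg[of "degree p"] \<open>p \<noteq> 0\<close> by (simp add: less_le)
  with nonneg have "(\<Sum>i\<le>degree p. coeff p i) > 0"
    by (intro sum_pos2[of _ "degree p"]) auto
  thus ?thesis by (simp add: poly_altdef)
qed

theorem corollary1p7:
  fixes f :: "int poly" and n :: nat
  assumes "n \<ge> 1"
    and "degree f = n"
    and "enestrom_kakeya (map_poly real_of_int f)"
    and "coeff f 0 \<noteq> 0"
    and "poly f (-1) \<noteq> 0"
    and "\<exists>b::int. \<bar>b\<bar> \<ge> 2 \<and> prime \<bar>poly f b\<bar>"
  shows "irreducible (map_poly rat_of_int f)"
proof -
  obtain b :: int where b: "\<bar>b\<bar> \<ge> 2" "prime \<bar>poly f b\<bar>"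
    using assms(6) by blast
  have f0: "f \<noteq> 0" using assms(4) by auto
  define F where "F = map_poly complex_of_int f"
  have F: "F = map_poly of_real (map_poly real_of_int f)"
    by (simp add: F_def map_poly_map_poly o_def)
  have R0: "map_poly real_of_int f \<noteq> 0"
    using f0 by (simp add: map_poly_eq_0_iff)
  have roots: "norm (of_int b - z) > 1" if z: "poly F z = 0" for z
  proof (rule norm_int_diff_gt_1[OF b(1)])
    show "norm z \<le> 1"
      using enestrom_kakeya_norm_root_le_1[OF assms(3) R0] z by (simp add: F)
    have "poly f 1 \<noteq> 0"
      using poly_1_pos_if_enestrom_kakeya[OF assms(3) R0] poly_map_poly_of_int[of f 1, where 'a = real]
      by auto
    thus "z \<noteq> 1"
      using z poly_map_poly_of_int[of f 1, where 'a = complex] by (auto simp: F_def)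
    show "z \<noteq> -1"
      using z assms(5) poly_map_poly_of_int[of f "-1", where 'a = complex] by (auto simp: F_def)
  qed
  \<comment> \<open>The roots of \<open>g\<close> are among those of \<open>f\<close>, and its
    leading coefficient, a nonzero integer, has absolute value at least 1.\<close>
  have factor_gt_1: "\<bar>poly g b\<bar> > 1" if "g dvd f" "degree g > 0" for g
  proof -
    have "norm (poly (map_poly complex_of_int g) (of_int b)) > 1"
    proof (rule norm_poly_gt_1)
      have "g \<noteq> 0" using that(2) by auto
      hence "\<bar>lead_coeff g\<bar> \<ge> 1" by (simp add: int_one_le_iff_zero_less)
      thus "norm (lead_coeff (map_poly complex_of_int g)) \<ge> 1"
        by (simp add: degree_map_poly coeff_map_poly)
      show "degree (map_poly complex_of_int g) > 0"
        using that(2) by (simp add: degree_map_poly)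
      show "norm (of_int b - z) > 1" if "poly (map_poly complex_of_int g) z = 0" for z
        using roots[of z] that \<open>g dvd f\<close> by (auto simp: F_def map_poly_of_int_mult elim!: dvdE)
    qed
    thus ?thesis
      unfolding poly_map_poly_of_int by (simp flip: of_int_abs)
  qed
  show ?thesis
  proof (rule irreducibleI)
    show "map_poly rat_of_int f \<noteq> 0"
      using f0 by (simp add: map_poly_eq_0_iff)
    show "\<not> is_unit (map_poly rat_of_int f)"
      using assms(1,2) by (auto simp: is_unit_iff_degree map_poly_eq_0_iff degree_map_poly f0)
  next
    fix g h assume gh: "map_poly rat_of_int f = g * h"
    obtain G H where GH: "f = G * H" "degree G = degree g" "degree H = degree h"
      using rat_factorization_imp_int_factorization[OF f0 gh] .
    \<comment> \<open>The prime \<open>\<bar>poly f b\<bar>\<close> is the product of these two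
      nonnegative integers, so one of them is a unit and hence 1.\<close>
    have "\<bar>poly G b\<bar> = 1 \<or> \<bar>poly H b\<bar> = 1"
      using irreducibleD[OF prime_elem_imp_irreducible[OF prime_imp_prime_elem[OF b(2)]], of "\<bar>poly G b\<bar>" "\<bar>poly H b\<bar>"]
      by (simp add: GH(1) abs_mult)
    hence "degree g = 0 \<or> degree h = 0"
      using factor_gt_1[of G] factor_gt_1[of H] GH by force
    moreover have "g \<noteq> 0" "h \<noteq> 0"
      using gh f0 by (auto simp: map_poly_eq_0_iff)
    ultimately show "is_unit g \<or> is_unit h"
      by (simp add: is_unit_iff_degree)
  qed
qed

end
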